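(* Let $\Omega\subseteq\mathbb{CP}^1$ be a semialgebraic set, and let $Str(\Omega)=\{s,ss,un\}$ with $s=\Omega$, $ss=\overline\Omega\setminus\Omega$, $un=\mathbb{CP}^1\setminus\overline\Omega$. Put $Adj(Str(\Omega))=\{(t_1,t_2)\in Str(\Omega)^2:\ \overline{t_1}\cap t_2\neq\varnothing\}$. Let $\tau=(t_s,t_{ss},t_{un})$ and $\eta=(q_s,q_{ss},q_{un})$ be $D$-strata with $\sum_{i\in Str(\Omega)}t_i=\sum_{i\in Str(\Omega)}q_i=m$. Then $\overline\tau\cap\eta\neq\varnothing$ if and only if there exists a family of natural numbers (possibly zero) $\{\mu_t: t\in Adj(Str(\Omega))\}$ such that for every $i\in Str(\Omega)$ $$\sum_{j:\,(j,i)\in Adj(Str(\Omega))}\mu_{(j,i)}=q_i,\qquad \sum_{j:\,(i,j)\in Adj(Str(\Omega))}\mu_{(i,j)}=t_i .$$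
   Context: $\mathbb{CP}^1$ is regarded as a real algebraic variety; closures are Euclidean. $(\mathbb{CP}^1)^{(m)}=(\mathbb{CP}^1)^m/\Sigma_m$ is the $m$-th symmetric product (multisets of $m$ points of $\mathbb{CP}^1$), identified with the projective space of nonzero complex binary forms of degree $m$ via roots. The $D$-stratum denoted by a triple $(t_s,t_{ss},t_{un})$ of nonnegative integers with sum $m$ is the set of all multisets in $(\mathbb{CP}^1)^{(m)}$ having, with multiplicity, exactly $t_s$ points in $\Omega$, $t_{ss}$ points in $\overline\Omega\setminus\Omega$ and $t_{un}$ points in $\mathbb{CP}^1\setminus\overline\Omega$. *)

theory Defs
  imports "HOL-Analysis.Analysis" "HOL-Library.Multiset"
begin

definition proj_rel :: "complex \<times> complex \<Rightarrow> complex \<times> complex \<Rightarrow> bool" where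
  "proj_rel u v \<longleftrightarrow> u \<noteq> 0 \<and> v \<noteq> 0 \<and> (\<exists>c. c \<noteq> 0 \<and> v = (c * fst u, c * snd u))"

text \<open>Quotient of the nonzero vectors: the abstraction \<open>abs_cp1 v\<close> is meaningful only for
  \<open>v \<noteq> 0\<close>.\<close>

quotient_type cp1 = "complex \<times> complex" / partial: proj_rel
proof (rule part_equivpI)
  show "\<exists>x. proj_rel x x"
    by (intro exI[of _ "(1, 1)"]) (auto simp: proj_rel_def zero_prod_def intro: exI[of _ 1])
  show "symp proj_rel"
  proof (rule sympI)
    fix u v assume "proj_rel u v"
    then obtain c where c: "u \<noteq> 0" "v \<noteq> 0" "c \<noteq> 0" "v = (c * fst u, c * snd u)"
      by (auto simp: proj_rel_def)
    then have "u = (inverse c * fst v, inverse c * snd v)"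
      by (simp add: prod_eq_iff)
    with c show "proj_rel v u"
      unfolding proj_rel_def using nonzero_imp_inverse_nonzero by blast
  qed
  show "transp proj_rel"
  proof (rule transpI)
    fix u v w assume "proj_rel u v" "proj_rel v w"
    then obtain c d where "u \<noteq> 0" "w \<noteq> 0" "c \<noteq> 0" "d \<noteq> 0"
      "v = (c * fst u, c * snd u)" "w = (d * fst v, d * snd v)"
      by (auto simp: proj_rel_def)
    then show "proj_rel u w"
      unfolding proj_rel_def by (auto intro!: exI[of _ "d * c"])
  qed
qed

instantiation cp1 :: topological_space
begin

text \<open>The quotient topology from \<open>\<complex>\<^sup>2 - {0}\<close>, which is open in \<open>\<complex>\<^sup>2\<close>.\<close>

definition open_cp1 :: "cp1 set \<Rightarrow> bool" where
  "open_cp1 U \<longleftrightarrow> open {v. v \<noteq> 0 \<and> abs_cp1 v \<in> U}"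

instance
proof
  have "{v. v \<noteq> 0 \<and> abs_cp1 v \<in> UNIV} = - {0}"
    by auto
  then show "open (UNIV :: cp1 set)"
    by (simp add: open_cp1_def open_Compl)
next
  fix S T :: "cp1 set"
  assume "open S" "open T"
  moreover have "{v. v \<noteq> 0 \<and> abs_cp1 v \<in> S \<inter> T} =
      {v. v \<noteq> 0 \<and> abs_cp1 v \<in> S} \<inter> {v. v \<noteq> 0 \<and> abs_cp1 v \<in> T}"
    by auto
  ultimately show "open (S \<inter> T)"
    by (simp add: open_cp1_def open_Int)
next
  fix K :: "cp1 set set"
  assume "\<forall>S\<in>K. open S"
  moreover have "{v. v \<noteq> 0 \<and> abs_cp1 v \<in> \<Union>K} = (\<Union>S\<in>K. {v. v \<noteq> 0 \<and> abs_cp1 v \<in> S})"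
    by auto
  ultimately show "open (\<Union>K)"
    unfolding open_cp1_def by auto
qed

end

text \<open>The Boolean algebra of sets generated by the sets \<open>{p > 0}\<close>, \<open>p\<close> a real polynomial;
  \<open>{p = 0}\<close> is the complement of \<open>{p > 0} \<union> {- p > 0}\<close>.\<close>

inductive semialgebraic :: "'a::euclidean_space set \<Rightarrow> bool" where
  pos: "real_polynomial_function p \<Longrightarrow> semialgebraic {x. p x > 0}"
| compl: "semialgebraic A \<Longrightarrow> semialgebraic (- A)"
| inter: "semialgebraic A \<Longrightarrow> semialgebraic B \<Longrightarrow> semialgebraic (A \<inter> B)"

text \<open>On the real algebraic variety \<open>\<complex>\<P>\<^sup>1\<close>: semialgebraic in both standard affine charts
  \<open>\<complex> = \<real>\<^sup>2\<close>.\<close>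

definition semialgebraic_cp1 :: "cp1 set \<Rightarrow> bool" where
  "semialgebraic_cp1 S \<longleftrightarrow>
     semialgebraic {z. abs_cp1 (z, 1) \<in> S} \<and> semialgebraic {z. abs_cp1 (1, z) \<in> S}"

definition power_space :: "nat \<Rightarrow> (nat \<Rightarrow> 'a::topological_space) topology" where
  "power_space m = product_topology (\<lambda>_. euclidean) {..<m}"

definition tuple_mset :: "nat \<Rightarrow> (nat \<Rightarrow> 'a) \<Rightarrow> 'a multiset" where
  "tuple_mset m f = image_mset f (mset_set {..<m})"

text \<open>The orbits of \<open>\<Sigma>\<^sub>m\<close> on the \<open>m\<close>-th power are the fibres of \<open>tuple_mset m\<close>, so the orbit
  space is the set of multisets of size \<open>m\<close> with the quotient topology.\<close>

definition sym_product :: "nat \<Rightarrow> 'a::topological_space multiset topology" where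
  "sym_product m = topology (\<lambda>U. U \<subseteq> {M. size M = m} \<and>
     openin (power_space m) {f \<in> topspace (power_space m). tuple_mset m f \<in> U})"

lemma openin_sym_product:
  "openin (sym_product m) U \<longleftrightarrow> U \<subseteq> {M. size M = m} \<and>
     openin (power_space m) {f \<in> topspace (power_space m). tuple_mset m f \<in> U}"
proof -
  let ?P = "power_space m :: (nat \<Rightarrow> 'a) topology"
  let ?L = "\<lambda>U. U \<subseteq> {M. size M = m} \<and> openin ?P {f \<in> topspace ?P. tuple_mset m f \<in> U}"
  have "istopology ?L"
    unfolding istopology_def
  proof (intro conjI allI impI)
    fix S T assume "?L S" "?L T"
    moreover have "{f \<in> topspace ?P. tuple_mset m f \<in> S \<inter> T} =
        {f \<in> topspace ?P. tuple_mset m f \<in> S} \<inter> {f \<in> topspace ?P. tuple_mset m f \<in> T}"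
      by auto
    ultimately show "S \<inter> T \<subseteq> {M. size M = m}"
      and "openin ?P {f \<in> topspace ?P. tuple_mset m f \<in> S \<inter> T}"
      by (auto intro: openin_Int)
  next
    fix K assume K: "\<forall>S\<in>K. ?L S"
    then show "\<Union>K \<subseteq> {M. size M = m}"
      by auto
    have "{f \<in> topspace ?P. tuple_mset m f \<in> \<Union>K} =
        (\<Union>S\<in>K. {f \<in> topspace ?P. tuple_mset m f \<in> S})"
      by auto
    with K show "openin ?P {f \<in> topspace ?P. tuple_mset m f \<in> \<Union>K}"
      by (auto intro!: openin_Union)
  qed
  then show ?thesis
    unfolding sym_product_def by (simp add: topology_inverse')
qed

lemma size_tuple_mset [simp]: "size (tuple_mset m f) = m"
  by (simp add: tuple_mset_def)

lemma topspace_sym_product: "topspace (sym_product m) = {M. size M = m}"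
proof -
  have "openin (sym_product m) {M. size M = m}"
    by (simp add: openin_sym_product)
  then show ?thesis
    by (metis openin_subset openin_sym_product openin_topspace subset_antisym)
qed

lemma tuple_mset_image:
  "tuple_mset m ` topspace (power_space m :: (nat \<Rightarrow> 'a::topological_space) topology) =
     {M. size M = m}"
proof (intro equalityI subsetI)
  fix M :: "'a multiset" assume "M \<in> {M. size M = m}"
  moreover obtain xs where xs: "mset xs = M"
    using ex_mset by blast
  ultimately have len: "length xs = m"
    by auto
  have "tuple_mset m (restrict ((!) xs) {..<m}) = image_mset ((!) xs) (mset_set {..<m})"
    unfolding tuple_mset_def by (rule image_mset_cong) simp
  also have "\<dots> = mset (map ((!) xs) [0..<m])"
    by (simp add: mset_map mset_upt atLeast0LessThan)
  also have "\<dots> = M"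
    using xs len by (metis map_nth)
  finally have "M = tuple_mset m (restrict ((!) xs) {..<m})"
    by simp
  moreover have "restrict ((!) xs) {..<m} \<in> topspace (power_space m)"
    by (simp add: power_space_def)
  ultimately show "M \<in> tuple_mset m ` topspace (power_space m)"
    by (rule image_eqI)
qed auto

lemma quotient_map_tuple_mset: "quotient_map (power_space m) (sym_product m) (tuple_mset m)"
  unfolding quotient_map_def topspace_sym_product
  by (simp add: tuple_mset_image openin_sym_product)

text \<open>The index set \<open>{s, ss, un}\<close>. These are labels rather than the three subsets themselves, since
  two of the subsets may be empty and hence equal.\<close>

datatype stratum = Stable | Semistable | Unstable

instance stratum :: finite
proof
  have "(UNIV :: stratum set) = {Stable, Semistable, Unstable}"
    using stratum.exhaust by blast
  then show "finite (UNIV :: stratum set)"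
    by (metis finite.emptyI finite_insert)
qed

fun stratum_set :: "cp1 set \<Rightarrow> stratum \<Rightarrow> cp1 set" where
  "stratum_set \<Omega> Stable = \<Omega>"
| "stratum_set \<Omega> Semistable = closure \<Omega> - \<Omega>"
| "stratum_set \<Omega> Unstable = - closure \<Omega>"

definition Adj :: "cp1 set \<Rightarrow> (stratum \<times> stratum) set" where
  "Adj \<Omega> = {(i, j). closure (stratum_set \<Omega> i) \<inter> stratum_set \<Omega> j \<noteq> {}}"

text \<open>Points are counted with multiplicity. A triple naming an unrealizable configuration denotes
  the empty set.\<close>

definition D_stratum :: "cp1 set \<Rightarrow> nat \<Rightarrow> (stratum \<Rightarrow> nat) \<Rightarrow> cp1 multiset set" where
  "D_stratum \<Omega> m t = {M \<in> topspace (sym_product m).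
     \<forall>i. size {#x \<in># M. x \<in> stratum_set \<Omega> i#} = t i}"

end

theory Submission
  imports Defs "HOL-Combinatorics.Permutations"
begin

text \<open>The theorem is a statement about finite colourings of topological spaces: colour a point of
  \<open>\<complex>\<P>\<^sup>1\<close> by the stratum that contains it.

  Since \<open>\<Sigma>\<^sub>m\<close> is finite, the orbit map to the symmetric product is open. Hence the multiset of a
  tuple \<open>g\<close> lies in the closure of \<open>A\<close> exactly if every box around \<open>g\<close> contains a tuple whose
  multiset is in \<open>A\<close> (\<open>in_closure_of_sym_product_iff\<close>). There are only finitely many colours,
  so each \<open>g k\<close> has a neighbourhood that avoids every colour class not adherent to \<open>g k\<close>. Testing
  with the box of these neighbourhoods gives points \<open>f k\<close>, with colours distributed as
  prescribed by \<open>t\<close>, such that \<open>g k\<close> is in the closure of the colour class of \<open>f k\<close>. Conversely,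
  if \<open>g k\<close> is in the closure of the class \<open>a k\<close>, then every box around \<open>g\<close> contains a tuple
  with colours \<open>a\<close>. So the closure of \<open>\<tau>\<close> meets \<open>\<eta>\<close> exactly if there are \<open>m\<close> adjacent pairs of
  colours whose first entries have the distribution \<open>t\<close> and whose second entries have the
  distribution \<open>q\<close>. Counting how often each pair occurs turns this into the existence of \<open>\<mu>\<close>
  (\<open>ex_transport_iff_ex_pairing\<close>).\<close>

section \<open>Closures in symmetric products\<close>

lemma tuple_mset_cong: "(\<And>k. k < m \<Longrightarrow> f k = g k) \<Longrightarrow> tuple_mset m f = tuple_mset m g"
  unfolding tuple_mset_def by (rule image_mset_cong) simp

lemma ex_tuple_mset:
  assumes "size M = m"
  obtains f where "M = tuple_mset m f"
proof -
  obtain xs where xs: "mset xs = M"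
    using ex_mset by blast
  have "tuple_mset m ((!) xs) = mset (map ((!) xs) [0..<m])"
    by (simp add: tuple_mset_def mset_map mset_upt atLeast0LessThan)
  also have "\<dots> = M"
    using xs assms by (metis map_nth size_mset)
  finally show thesis
    by (rule that[OF sym])
qed

lemma size_filter_tuple_mset:
  "size {#x \<in># tuple_mset m f. P x#} = card {k. k < m \<and> P (f k)}"
proof -
  have "size {#x \<in># tuple_mset m f. P x#} = size (filter_mset (\<lambda>k. P (f k)) (mset_set {..<m}))"
    by (simp add: tuple_mset_def filter_mset_image_mset)
  also have "\<dots> = card {k \<in> {..<m}. P (f k)}"
    by simp
  finally show ?thesis
    by simp
qed

text \<open>Openness of the orbit map on boxes: the tuples in the orbits that meet a box form the union
  of the finitely many permuted boxes.\<close>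

lemma openin_sym_product_box:
  fixes U :: "nat \<Rightarrow> 'a::topological_space set"
  assumes "\<And>k. k < m \<Longrightarrow> open (U k)"
  shows "openin (sym_product m) (tuple_mset m ` PiE {..<m} U)"
  unfolding openin_sym_product
proof
  show "tuple_mset m ` PiE {..<m} U \<subseteq> {M. size M = m}"
    using size_tuple_mset by blast
  let ?P = "power_space m :: (nat \<Rightarrow> 'a) topology"
  have "{f \<in> topspace ?P. tuple_mset m f \<in> tuple_mset m ` PiE {..<m} U}
      = (\<Union>p\<in>{p. p permutes {..<m}}. PiE {..<m} (\<lambda>k. U (p k)))" (is "?L = ?R")
  proof (intro equalityI subsetI)
    fix f assume f: "f \<in> ?L"
    then obtain h where h: "h \<in> PiE {..<m} U" "tuple_mset m f = tuple_mset m h"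
      by auto
    obtain p where p: "p permutes {..<m}" "\<forall>k\<in>{..<m}. f k = h (p k)"
      by (rule image_mset_eq_implies_permutes[OF _ h(2)[unfolded tuple_mset_def]]) auto
    have "f k \<in> U (p k)" if "k < m" for k
      using p h(1) that permutes_in_image[OF p(1), of k] by (auto simp: PiE_iff)
    then have "f \<in> PiE {..<m} (\<lambda>k. U (p k))"
      using f by (auto simp: PiE_iff power_space_def)
    with p(1) show "f \<in> ?R"
      by blast
  next
    fix f assume "f \<in> ?R"
    then obtain p where p: "p permutes {..<m}" and f: "f \<in> PiE {..<m} (\<lambda>k. U (p k))"
      by blast
    let ?h = "restrict (\<lambda>k. f (inv p k)) {..<m}"
    have inv: "inv p k < m \<and> p (inv p k) = k" if "k < m" for k
      using permutes_in_image[OF permutes_inv[OF p], of k] permutes_inverses(1)[OF p] that by simp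
    have "?h \<in> PiE {..<m} U"
    proof (rule restrict_PiE_iff[THEN iffD2], rule ballI)
      fix k assume "k \<in> {..<m}"
      then show "f (inv p k) \<in> U k"
        using inv[of k] PiE_mem[OF f, of "inv p k"] by simp
    qed
    moreover have "tuple_mset m ?h = tuple_mset m f"
    proof -
      have "?h k = f (inv p k)" if "k \<in> {..<m}" for k
        using that by simp
      then show ?thesis
        unfolding tuple_mset_def
        by (rule permutes_implies_image_mset_eq[OF permutes_inv[OF p], symmetric])
    qed
    ultimately have "tuple_mset m f \<in> tuple_mset m ` PiE {..<m} U"
      by (intro image_eqI[of _ _ ?h]) simp_all
    then show "f \<in> ?L"
      using f by (simp add: PiE_iff power_space_def)
  qed
  moreover have "openin ?P ?R"
  proof (intro openin_Union ballI; clarify)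
    fix p assume p: "p permutes {..<m}"
    have "open (U (p k))" if "k < m" for k
      using assms permutes_in_image[OF p, of k] that by simp
    then show "openin ?P (PiE {..<m} (\<lambda>k. U (p k)))"
      by (simp add: power_space_def openin_PiE)
  qed
  ultimately show "openin ?P ?L"
    by simp
qed

text \<open>Boxes around one representative tuple suffice as neighbourhoods of its multiset: their
  images are neighbourhoods by openness of the orbit map, and they are arbitrarily small by its
  continuity.\<close>

lemma in_closure_of_sym_product_iff:
  fixes g :: "nat \<Rightarrow> 'a::topological_space"
  shows "tuple_mset m g \<in> sym_product m closure_of A \<longleftrightarrow>
    (\<forall>U. (\<forall>k<m. open (U k) \<and> g k \<in> U k) \<longrightarrow>
       (\<exists>f. tuple_mset m f \<in> A \<and> (\<forall>k<m. f k \<in> U k)))" (is "?L \<longleftrightarrow> ?R")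
proof
  assume L: ?L
  show ?R
  proof (intro allI impI)
    fix U assume U: "\<forall>k<m. open (U k) \<and> g k \<in> U k"
    have "openin (sym_product m) (tuple_mset m ` PiE {..<m} U)"
      using U by (intro openin_sym_product_box) simp
    moreover have "tuple_mset m g \<in> tuple_mset m ` PiE {..<m} U"
      using U by (intro image_eqI[of _ _ "restrict g {..<m}"] tuple_mset_cong) auto
    ultimately have "\<exists>M. M \<in> A \<and> M \<in> tuple_mset m ` PiE {..<m} U"
      by (intro L[unfolded in_closure_of, THEN conjunct2, rule_format] conjI)
    then show "\<exists>f. tuple_mset m f \<in> A \<and> (\<forall>k<m. f k \<in> U k)"
      by (auto simp: PiE_iff)
  qed
next
  assume R: ?R
  show ?L
    unfolding in_closure_of
  proof (intro conjI allI impI)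
    show "tuple_mset m g \<in> topspace (sym_product m)"
      by (simp add: topspace_sym_product)
    fix T assume T: "tuple_mset m g \<in> T \<and> openin (sym_product m) T"
    let ?W = "{f \<in> topspace (power_space m). tuple_mset m f \<in> T}"
    have W: "openin (power_space m) ?W"
      using T by (simp add: openin_sym_product)
    have "restrict g {..<m} \<in> ?W"
      using T tuple_mset_cong[of m "restrict g {..<m}" g] by (simp add: power_space_def)
    then have "\<exists>U. finite {k \<in> {..<m}. U k \<noteq> topspace euclidean} \<and>
        (\<forall>k\<in>{..<m}. openin euclidean (U k)) \<and> restrict g {..<m} \<in> PiE {..<m} U \<and>
        PiE {..<m} U \<subseteq> ?W"
      by (rule bspec[OF W[unfolded power_space_def openin_product_topology_alt,
          folded power_space_def]])
    then obtain U where U: "\<forall>k\<in>{..<m}. openin euclidean (U k)"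
        "restrict g {..<m} \<in> PiE {..<m} U" "PiE {..<m} U \<subseteq> ?W"
      by (elim exE conjE)
    have "\<forall>k<m. open (U k) \<and> g k \<in> U k"
      using U(1,2) by (simp add: restrict_PiE_iff Pi_iff)
    then have "\<exists>f. tuple_mset m f \<in> A \<and> (\<forall>k<m. f k \<in> U k)"
      using R by simp
    then obtain f where f: "tuple_mset m f \<in> A" "\<forall>k<m. f k \<in> U k"
      by (elim exE conjE)
    then have "restrict f {..<m} \<in> PiE {..<m} U"
      by (simp add: restrict_PiE_iff)
    with U(3) have "restrict f {..<m} \<in> ?W"
      by (rule subsetD)
    then have "tuple_mset m f \<in> T"
      using tuple_mset_cong[of m "restrict f {..<m}" f] by simp
    with f(1) show "\<exists>M. M \<in> A \<and> M \<in> T"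
      by blast
  qed
qed

section \<open>Transport matrices and pairings\<close>

text \<open>A matrix of natural numbers supported on \<open>R\<close> with prescribed margins is the same as a
  multiset of pairs in \<open>R\<close> whose projections have these distributions; an enumeration of the
  multiset gives \<open>a\<close> and \<open>b\<close>.\<close>

lemma ex_transport_iff_ex_pairing:
  fixes R :: "('i::finite \<times> 'i) set" and t q :: "'i \<Rightarrow> nat"
  assumes "(\<Sum>i\<in>UNIV. t i) = m"
  shows "(\<exists>\<mu> :: 'i \<times> 'i \<Rightarrow> nat. \<forall>i.
      (\<Sum>j | (j, i) \<in> R. \<mu> (j, i)) = q i \<and> (\<Sum>j | (i, j) \<in> R. \<mu> (i, j)) = t i) \<longleftrightarrow>
    (\<exists>a b. (\<forall>k<m. (a k, b k) \<in> R) \<and>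
      (\<forall>i. card {k. k < m \<and> a k = i} = t i \<and> card {k. k < m \<and> b k = i} = q i))"
    (is "?L \<longleftrightarrow> ?R")
proof
  assume ?L
  then obtain \<mu> :: "'i \<times> 'i \<Rightarrow> nat" where
    \<mu>: "\<And>i. (\<Sum>j | (j, i) \<in> R. \<mu> (j, i)) = q i" "\<And>i. (\<Sum>j | (i, j) \<in> R. \<mu> (i, j)) = t i"
    by blast
  define P where "P = (\<Sum>p\<in>R. replicate_mset (\<mu> p) p)"
  have size_P: "size {#p \<in># P. Q p#} = (\<Sum>p | p \<in> R \<and> Q p. \<mu> p)" for Q
  proof -
    have "size {#p \<in># (\<Sum>p\<in>S. replicate_mset (\<mu> p) p). Q p#} = (\<Sum>p | p \<in> S \<and> Q p. \<mu> p)"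
      if "finite S" for S
      using that
    proof (induction S)
      case (insert x S)
      have "filter_mset Q (replicate_mset n x) = (if Q x then replicate_mset n x else {#})" for n
        by (induction n) auto
      moreover
      have "{p. p \<in> insert x S \<and> Q p} = (if Q x then {x} else {}) \<union> {p. p \<in> S \<and> Q p}"
        by auto
      ultimately show ?case
        using insert by simp
    qed simp
    then show ?thesis
      by (simp add: P_def)
  qed
  have fst_P: "size {#p \<in># P. fst p = i#} = t i" for i
  proof -
    have "{p. p \<in> R \<and> fst p = i} = Pair i ` {j. (i, j) \<in> R}"
      by auto
    then show ?thesis
      by (simp add: size_P sum.reindex inj_on_def \<mu>(2)[symmetric])
  qed
  have snd_P: "size {#p \<in># P. snd p = i#} = q i" for i
  proof -
    have "{p. p \<in> R \<and> snd p = i} = (\<lambda>j. (j, i)) ` {j. (j, i) \<in> R}"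
      by auto
    then show ?thesis
      by (simp add: size_P sum.reindex inj_on_def \<mu>(1)[symmetric])
  qed
  have "size P = (\<Sum>p\<in>R. \<mu> p)"
    using size_P[of "\<lambda>_. True"] by simp
  also have "\<dots> = (\<Sum>i\<in>UNIV. \<Sum>p | p \<in> R \<and> fst p = i. \<mu> p)"
    by (rule sum.group[symmetric]) auto
  also have "\<dots> = m"
    using assms by (simp add: size_P[symmetric] fst_P)
  finally obtain c where c: "P = tuple_mset m c"
    by (rule ex_tuple_mset)
  have "c k \<in> R" if "k < m" for k
  proof -
    have "c k \<in># P"
      using that by (simp add: c tuple_mset_def)
    then show ?thesis
      by (auto simp: P_def set_mset_sum split: if_splits)
  qed
  then show ?R
    using fst_P snd_P
    by (intro exI[of _ "\<lambda>k. fst (c k)"] exI[of _ "\<lambda>k. snd (c k)"])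
       (simp add: c size_filter_tuple_mset)
next
  assume ?R
  then obtain a b where ab: "\<And>k. k < m \<Longrightarrow> (a k, b k) \<in> R"
    "\<And>i. card {k. k < m \<and> a k = i} = t i" "\<And>i. card {k. k < m \<and> b k = i} = q i"
    by blast
  define \<mu> where "\<mu> p = card {k. k < m \<and> (a k, b k) = p}" for p
  have "(\<Sum>j | (j, i) \<in> R. \<mu> (j, i)) = q i" for i
  proof -
    have "(\<Sum>j | (j, i) \<in> R. \<mu> (j, i))
        = card (\<Union>j\<in>{j. (j, i) \<in> R}. {k. k < m \<and> (a k, b k) = (j, i)})"
      unfolding \<mu>_def by (subst card_UN_disjoint) auto
    also have "(\<Union>j\<in>{j. (j, i) \<in> R}. {k. k < m \<and> (a k, b k) = (j, i)}) = {k. k < m \<and> b k = i}"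
      using ab(1) by auto
    finally show ?thesis
      by (simp add: ab(3))
  qed
  moreover have "(\<Sum>j | (i, j) \<in> R. \<mu> (i, j)) = t i" for i
  proof -
    have "(\<Sum>j | (i, j) \<in> R. \<mu> (i, j))
        = card (\<Union>j\<in>{j. (i, j) \<in> R}. {k. k < m \<and> (a k, b k) = (i, j)})"
      unfolding \<mu>_def by (subst card_UN_disjoint) auto
    also have "(\<Union>j\<in>{j. (i, j) \<in> R}. {k. k < m \<and> (a k, b k) = (i, j)}) = {k. k < m \<and> a k = i}"
      using ab(1) by auto
    finally show ?thesis
      by (simp add: ab(2))
  qed
  ultimately show ?L
    by blast
qed

section \<open>Strata of multisets in a coloured space\<close>

definition colour_stratum :: "('a \<Rightarrow> 'i) \<Rightarrow> nat \<Rightarrow> ('i \<Rightarrow> nat) \<Rightarrow> 'a multiset set" where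
  "colour_stratum c m t = {M. size M = m \<and> (\<forall>i. size {#x \<in># M. c x = i#} = t i)}"

lemma tuple_mset_in_colour_stratum_iff:
  "tuple_mset m f \<in> colour_stratum c m t \<longleftrightarrow> (\<forall>i. card {k. k < m \<and> c (f k) = i} = t i)"
  by (simp add: colour_stratum_def size_filter_tuple_mset)

text \<open>Points can be moved independently into adherent colour classes, and a sufficiently small
  move leads into adherent classes only. Finiteness of the set of colours is what makes the
  neighbourhoods in the forward direction open.\<close>

lemma closure_colour_stratum_meets_iff:
  fixes c :: "'a::topological_space \<Rightarrow> 'i::finite"
  shows "(sym_product m closure_of colour_stratum c m t) \<inter> colour_stratum c m q \<noteq> {} \<longleftrightarrow>
    (\<exists>a b. (\<forall>k<m. closure (c -` {a k}) \<inter> c -` {b k} \<noteq> {}) \<and>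
      (\<forall>i. card {k. k < m \<and> a k = i} = t i \<and> card {k. k < m \<and> b k = i} = q i))"
    (is "?L \<longleftrightarrow> ?R")
proof
  assume ?L
  then obtain M where M: "M \<in> sym_product m closure_of colour_stratum c m t"
    "M \<in> colour_stratum c m q"
    by blast
  obtain g where g: "M = tuple_mset m g"
    using M(2) ex_tuple_mset[of M m] unfolding colour_stratum_def by blast
  define U where "U k = - (\<Union>i\<in>{i. g k \<notin> closure (c -` {i})}. closure (c -` {i}))" for k
  have "open (U k)" for k
    unfolding U_def by (intro open_Compl closed_UN) auto
  moreover have "g k \<in> U k" for k
    unfolding U_def by auto
  ultimately obtain f where f: "tuple_mset m f \<in> colour_stratum c m t" "\<forall>k<m. f k \<in> U k"
    using M(1) unfolding g in_closure_of_sym_product_iff by blast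
  have "g k \<in> closure (c -` {c (f k)})" if "k < m" for k
  proof -
    have "f k \<in> closure (c -` {c (f k)})"
      by (rule subsetD[OF closure_subset]) simp
    then show ?thesis
      using f(2) that unfolding U_def by blast
  qed
  then have "\<forall>k<m. closure (c -` {c (f k)}) \<inter> c -` {c (g k)} \<noteq> {}"
    by blast
  then show ?R
    using f(1) M(2) unfolding g tuple_mset_in_colour_stratum_iff
    by (intro exI[of _ "\<lambda>k. c (f k)"] exI[of _ "\<lambda>k. c (g k)"]) simp
next
  assume ?R
  then obtain a b where ab: "\<forall>k<m. closure (c -` {a k}) \<inter> c -` {b k} \<noteq> {}"
    "\<And>i. card {k. k < m \<and> a k = i} = t i" "\<And>i. card {k. k < m \<and> b k = i} = q i"
    by blast
  have "\<forall>k. \<exists>x. k < m \<longrightarrow> x \<in> closure (c -` {a k}) \<and> c x = b k"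
    using ab(1) by blast
  then obtain g where g: "\<And>k. k < m \<Longrightarrow> g k \<in> closure (c -` {a k}) \<and> c (g k) = b k"
    by metis
  have "tuple_mset m g \<in> sym_product m closure_of colour_stratum c m t"
    unfolding in_closure_of_sym_product_iff
  proof (intro allI impI)
    fix U assume U: "\<forall>k<m. open (U k) \<and> g k \<in> U k"
    have "\<exists>x. k < m \<longrightarrow> x \<in> U k \<and> c x = a k" for k
    proof (cases "k < m")
      case True
      then have "U k \<inter> closure (c -` {a k}) \<noteq> {}"
        using U g by blast
      then have "U k \<inter> c -` {a k} \<noteq> {}"
        using U True by (simp add: open_Int_closure_eq_empty)
      then show ?thesis
        by blast
    qed simp
    then obtain f where f: "\<And>k. k < m \<Longrightarrow> f k \<in> U k \<and> c (f k) = a k"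
      by metis
    then have "{k. k < m \<and> c (f k) = i} = {k. k < m \<and> a k = i}" for i
      by auto
    then have "tuple_mset m f \<in> colour_stratum c m t"
      by (simp add: tuple_mset_in_colour_stratum_iff ab(2))
    with f show "\<exists>f. tuple_mset m f \<in> colour_stratum c m t \<and> (\<forall>k<m. f k \<in> U k)"
      by blast
  qed
  moreover have "{k. k < m \<and> c (g k) = i} = {k. k < m \<and> b k = i}" for i
    using g by auto
  then have "tuple_mset m g \<in> colour_stratum c m q"
    by (simp add: tuple_mset_in_colour_stratum_iff ab(3))
  ultimately show ?L
    by blast
qed

section \<open>The strata of a subset of the projective line\<close>

definition stratum_of :: "cp1 set \<Rightarrow> cp1 \<Rightarrow> stratum" where
  "stratum_of \<Omega> x =
     (if x \<in> \<Omega> then Stable else if x \<in> closure \<Omega> then Semistable else Unstable)"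

lemma in_stratum_set_iff: "x \<in> stratum_set \<Omega> i \<longleftrightarrow> stratum_of \<Omega> x = i"
  using closure_subset[of \<Omega>] by (cases i) (auto simp: stratum_of_def)

lemma D_stratum_eq_colour_stratum: "D_stratum \<Omega> m t = colour_stratum (stratum_of \<Omega>) m t"
  by (simp add: D_stratum_def colour_stratum_def topspace_sym_product in_stratum_set_iff)

lemma in_Adj_iff:
  "(i, j) \<in> Adj \<Omega> \<longleftrightarrow> closure (stratum_of \<Omega> -` {i}) \<inter> stratum_of \<Omega> -` {j} \<noteq> {}"
proof -
  have "stratum_set \<Omega> l = stratum_of \<Omega> -` {l}" for l
    by (auto simp: in_stratum_set_iff)
  then show ?thesis
    by (simp add: Adj_def)
qed

theorem theorem3:
  fixes \<Omega> :: "cp1 set" and t q :: "stratum \<Rightarrow> nat" and m :: nat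
  assumes "semialgebraic_cp1 \<Omega>"
    and "(\<Sum>i\<in>UNIV. t i) = m" and "(\<Sum>i\<in>UNIV. q i) = m"
  shows "(sym_product m closure_of D_stratum \<Omega> m t) \<inter> D_stratum \<Omega> m q \<noteq> {} \<longleftrightarrow>
    (\<exists>\<mu> :: stratum \<times> stratum \<Rightarrow> nat. \<forall>i.
       (\<Sum>j | (j, i) \<in> Adj \<Omega>. \<mu> (j, i)) = q i \<and>
       (\<Sum>j | (i, j) \<in> Adj \<Omega>. \<mu> (i, j)) = t i)"
  unfolding D_stratum_eq_colour_stratum closure_colour_stratum_meets_iff in_Adj_iff[symmetric]
  by (rule ex_transport_iff_ex_pairing[OF assms(2), symmetric])

end
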